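(* There is a $1$-PDDS$[Q_3]$ in $\Lambda_3$, where $Q_3=P_2\square P_2\square P_2$ is the $3$-dimensional hypercube.
   Context: $\Lambda_3$ is the infinite graph with vertex set $\mathbb{Z}^3$ in which two vertices are adjacent iff their Euclidean distance is $1$; $d$ denotes graph distance. For $S$ a set of vertices, $[S]$ is the induced subgraph and $d(v,C)=\min\{d(v,w):w\in C\}$. For $t\ge1$, $S$ is a $t$-perfect distance-dominating set ($t$-PDDS) if for each vertex $v$ there is a unique component $C_v$ of $[S]$ with $d(v,C_v)\le t$, and there is in $C_v$ a unique vertex $w$ with $d(v,w)=d(v,C_v)$. A $t$-PDDS$[H]$ is a $t$-PDDS all of whose components are isomorphic to the fixed finite graph $H$. $P_2$ is the path on $2$ vertices and $\square$ is the Cartesian product of graphs. *)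

theory Defs
  imports "HOL-Analysis.Analysis" "Graph_Theory.Graph_Theory"
begin

text \<open>
  Undirected graphs are symmetric digraphs: an edge is a pair of opposite arcs. A
  \<^typ>\<open>'a pair_pre_digraph\<close> is coerced to a \<^typ>\<open>('a, 'a \<times> 'a) pre_digraph\<close>
  by \<^const>\<open>with_proj\<close>. For symmetric digraphs the strongly connected components
  \<^const>\<open>pre_digraph.sccs\<close> are the connected components.
\<close>

definition lattice3 :: "(int ^ 3) pair_pre_digraph" where
  "lattice3 = \<lparr> pverts = UNIV,
     parcs = {(x, y). dist (\<chi> i. real_of_int (x $ i)) (\<chi> i. real_of_int (y $ i)) = 1} \<rparr>"

definition path_graph :: "nat \<Rightarrow> nat pair_pre_digraph" where
  "path_graph n = \<lparr> pverts = {..<n},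
     parcs = {(i, j). i < n \<and> j < n \<and> (j = Suc i \<or> i = Suc j)} \<rparr>"

definition cartesian_product ::
  "'a pair_pre_digraph \<Rightarrow> 'b pair_pre_digraph \<Rightarrow> ('a \<times> 'b) pair_pre_digraph"  (infixr \<open>\<box>\<close> 70)
where
  "G \<box> H = \<lparr> pverts = pverts G \<times> pverts H,
     parcs = {((a, b), (a', b')).
       a = a' \<and> a \<in> pverts G \<and> (b, b') \<in> parcs H \<or>
       (a, a') \<in> parcs G \<and> b = b' \<and> b \<in> pverts H} \<rparr>"

definition hypercube3 :: "(nat \<times> nat \<times> nat) pair_pre_digraph" where
  "hypercube3 = path_graph 2 \<box> path_graph 2 \<box> path_graph 2"

text \<open>
  Graph distance is the least cost of a walk when every arc has cost 1; it is
  \<open>\<infinity>\<close> if there is no walk. The finite values are natural numbers, so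
  the infimum in \<open>graph_dist_set\<close> is a minimum for nonempty \<open>C\<close>. The constant
  \<^const>\<open>wf_digraph.\<mu>\<close> is only specified for well-formed digraphs.
\<close>

definition graph_dist :: "('a, 'b) pre_digraph \<Rightarrow> 'a \<Rightarrow> 'a \<Rightarrow> ereal" where
  "graph_dist G u v = wf_digraph.\<mu> G (\<lambda>_. 1) u v"

definition graph_dist_set :: "('a, 'b) pre_digraph \<Rightarrow> 'a \<Rightarrow> 'a set \<Rightarrow> ereal" where
  "graph_dist_set G v C = (INF w\<in>C. graph_dist G v w)"

text \<open>Distances are measured in \<open>G\<close>, not in the subgraph induced by \<open>S\<close>.\<close>

definition PDDS :: "('a, 'b) pre_digraph \<Rightarrow> nat \<Rightarrow> 'a set \<Rightarrow> bool" where
  "PDDS G t S \<longleftrightarrow> 1 \<le> t \<and> S \<subseteq> verts G \<and>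
     (\<forall>v\<in>verts G.
        (\<exists>!C. C \<in> pre_digraph.sccs (G \<restriction> S) \<and> graph_dist_set G v (verts C) \<le> ereal (real t)) \<and>
        (\<forall>C\<in>pre_digraph.sccs (G \<restriction> S). graph_dist_set G v (verts C) \<le> ereal (real t) \<longrightarrow>
           (\<exists>!w. w \<in> verts C \<and> graph_dist G v w = graph_dist_set G v (verts C))))"

definition PDDS_of ::
  "('a, 'b) pre_digraph \<Rightarrow> nat \<Rightarrow> ('c, 'd) pre_digraph \<Rightarrow> 'a set \<Rightarrow> bool"
where
  "PDDS_of G t H S \<longleftrightarrow> PDDS G t S \<and> (\<forall>C\<in>pre_digraph.sccs (G \<restriction> S). digraph_iso C H)"

lemma lattice3_bidirected: "pair_bidirected_digraph lattice3"
proof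
  show "symmetric (with_proj lattice3)"
    unfolding symmetric_def arcs_ends_conv
    by (rule symI) (auto simp: lattice3_def dist_commute)
qed (auto simp: lattice3_def)

lemma path_graph_pair_graph: "pair_graph (path_graph n)"
proof
  have "parcs (path_graph n) \<subseteq> {..<n} \<times> {..<n}"
    by (auto simp: path_graph_def)
  then show "finite (parcs (path_graph n))"
    by (rule finite_subset) simp
  show "symmetric (with_proj (path_graph n))"
    unfolding symmetric_def arcs_ends_conv
    by (rule symI) (auto simp: path_graph_def)
qed (auto simp: path_graph_def)

lemma cartesian_product_pair_graph:
  assumes "pair_graph G" "pair_graph H"
  shows "pair_graph (G \<box> H)"
proof -
  interpret G: pair_graph G by fact
  interpret H: pair_graph H by fact
  have symG: "(b, a) \<in> parcs G" if "(a, b) \<in> parcs G" for a b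
    using G.arcs_symmetric that by blast
  have symH: "(b, a) \<in> parcs H" if "(a, b) \<in> parcs H" for a b
    using H.arcs_symmetric that by blast
  have sub: "parcs (G \<box> H) \<subseteq> pverts (G \<box> H) \<times> pverts (G \<box> H)"
    by (auto simp: cartesian_product_def dest: G.in_arcsD1 G.in_arcsD2 H.in_arcsD1 H.in_arcsD2)
  have fin: "finite (pverts (G \<box> H))"
    by (simp add: cartesian_product_def)
  show ?thesis
  proof
    show "finite (parcs (G \<box> H))"
      by (rule finite_subset[OF sub]) (simp add: fin)
    show "symmetric (with_proj (G \<box> H))"
      unfolding symmetric_def arcs_ends_conv
      by (rule symI) (auto simp: cartesian_product_def intro: symG symH)
  next
    fix e assume e: "e \<in> parcs (G \<box> H)"
    show "fst e \<in> pverts (G \<box> H)" "snd e \<in> pverts (G \<box> H)"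
      using e sub by auto
    show "fst e \<noteq> snd e"
      using e G.no_loops' H.no_loops' by (auto simp: cartesian_product_def)
  qed (rule fin)
qed

lemma hypercube3_pair_graph: "pair_graph hypercube3"
  unfolding hypercube3_def by (intro cartesian_product_pair_graph path_graph_pair_graph)

end

theory Submission
  imports Defs
begin

text \<open>
  Cut \<open>\<int>\<^sup>n\<close> into the blocks \<open>2 b + {0,1}\<^sup>n\<close>, each of which induces an \<open>n\<close>-cube, and let \<open>S\<close>
  be the union of the blocks whose index \<open>b\<close> reduces modulo 2 to a word of a perfect code \<open>C\<close> of
  covering radius 1. A step of the lattice either stays inside a block or changes exactly one
  coordinate of \<open>b\<close> by one, so that it follows an edge of the cube of parities; conversely, every
  edge of that cube at the parity of \<open>b\<close> lifts to a unique step from a given vertex of the block.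
  As no two words of \<open>C\<close> are adjacent, the components of \<open>S\<close> are its blocks; as a word outside
  \<open>C\<close> is adjacent to exactly one word of \<open>C\<close>, a vertex outside \<open>S\<close> has exactly one neighbour in
  \<open>S\<close>. For \<open>n = 3\<close> the repetition code \<open>{000, 111}\<close> is perfect.
\<close>

section \<open>Graph distance\<close>

lemma INF_ereal_nat_le_iff:
  fixes f :: "'a \<Rightarrow> nat"
  shows "(INF x\<in>A. ereal (real (f x))) \<le> ereal (real n) \<longleftrightarrow> (\<exists>x\<in>A. f x \<le> n)"
proof
  show "\<exists>x\<in>A. f x \<le> n" if le: "(INF x\<in>A. ereal (real (f x))) \<le> ereal (real n)"
  proof (rule ccontr)
    assume "\<not> (\<exists>x\<in>A. f x \<le> n)"
    then have "ereal (real (Suc n)) \<le> (INF x\<in>A. ereal (real (f x)))"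
      by (intro INF_greatest) (auto simp: not_le Suc_le_eq)
    from order_trans[OF this le] show False
      by simp
  qed
qed (auto intro: INF_lower2)

context wf_digraph
begin

lemma graph_dist_eq_INF_length:
  "graph_dist G u v = (INF p\<in>{p. awalk u p v}. ereal (real (length p)))"
  by (simp add: graph_dist_def \<mu>_def awalk_cost_def sum_list_triv)

lemma graph_dist_le_iff:
  "graph_dist G u v \<le> ereal (real n) \<longleftrightarrow> (\<exists>p. awalk u p v \<and> length p \<le> n)"
  by (simp add: graph_dist_eq_INF_length INF_ereal_nat_le_iff)

lemma graph_dist_le_0_iff: "graph_dist G u v \<le> 0 \<longleftrightarrow> u = v \<and> u \<in> verts G"
  using graph_dist_le_iff[of u v 0] by (simp add: awalk_Nil_iff zero_ereal_def)

lemma graph_dist_le_1_iff: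
  "graph_dist G u v \<le> 1 \<longleftrightarrow> u = v \<and> u \<in> verts G \<or> u \<rightarrow>\<^bsub>G\<^esub> v"
proof -
  have "(\<exists>p. awalk u p v \<and> length p \<le> 1) \<longleftrightarrow> awalk u [] v \<or> (\<exists>e. awalk u [e] v)"
    by (auto simp: le_Suc_eq length_Suc_conv)
  then show ?thesis
    using graph_dist_le_iff[of u v 1]
    by (auto simp: awalk_Nil_iff awalk_Cons_iff one_ereal_def arcs_ends_conv image_iff)
qed

lemma graph_dist_set_le_iff:
  "graph_dist_set G u C \<le> ereal (real n) \<longleftrightarrow> (\<exists>w\<in>C. graph_dist G u w \<le> ereal (real n))"
proof -
  have "graph_dist_set G u C = (INF p\<in>(\<Union>w\<in>C. {p. awalk u p w}). ereal (real (length p)))"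
    unfolding graph_dist_set_def graph_dist_eq_INF_length
    by (rule antisym) (blast intro: INF_greatest INF_lower2 INF_lower)+
  then show ?thesis
    by (auto simp: INF_ereal_nat_le_iff graph_dist_le_iff)
qed

lemma ex1_nearest_in_subset:
  assumes ball: "{w \<in> S. graph_dist G v w \<le> ereal (real n)} = {p}" and "p \<in> C" "C \<subseteq> S"
  shows "\<exists>!w. w \<in> C \<and> graph_dist G v w = graph_dist_set G v C"
proof -
  have closer: "graph_dist G v p < graph_dist G v w" if "w \<in> C - {p}" for w
  proof -
    have "graph_dist G v p \<le> ereal (real n)" "ereal (real n) < graph_dist G v w"
      using that ball \<open>C \<subseteq> S\<close> by (auto simp flip: not_le)
    then show ?thesis
      by (rule le_less_trans)
  qed
  have "graph_dist_set G v C = graph_dist G v p"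
    unfolding graph_dist_set_def
  proof (rule INF_eqI)
    show "graph_dist G v p \<le> graph_dist G v w" if "w \<in> C" for w
      using that closer[of w] by (cases "w = p") auto
  qed (use \<open>p \<in> C\<close> in blast)
  then show ?thesis
    using \<open>p \<in> C\<close> closer by (metis DiffI less_irrefl singletonD)
qed

end

section \<open>Strong components\<close>

context wf_digraph
begin

lemma sccs_conv_scc_of: "sccs = (\<lambda>u. G \<restriction> scc_of u) ` verts G"
  by (simp add: sccs_conv_sccs_verts sccs_verts_conv_scc_of image_image)

lemma scc_eq_induce_scc_of:
  assumes "C \<in> sccs" "u \<in> verts C"
  shows "C = G \<restriction> scc_of u"
proof -
  obtain w where "C = G \<restriction> scc_of w"
    using assms(1) by (auto simp: sccs_conv_scc_of)
  then show ?thesis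
    using assms(2) scc_of_eq[of u w] by simp
qed

lemma ex1_scc_containing:
  assumes "u \<in> verts G"
  shows "\<exists>!C. C \<in> sccs \<and> u \<in> verts C"
proof (rule ex1I[of _ "G \<restriction> scc_of u"])
  show "G \<restriction> scc_of u \<in> sccs \<and> u \<in> verts (G \<restriction> scc_of u)"
    using assms by (simp add: sccs_conv_scc_of in_scc_of_self)
qed (elim conjE, rule scc_eq_induce_scc_of)

lemma verts_scc_subset:
  assumes "C \<in> sccs"
  shows "verts C \<subseteq> verts G"
  using in_sccs_imp_induced[OF assms] by (auto simp: induced_subgraph_def subgraph_def)

lemma scc_of_eq_fibre:
  assumes "u \<in> verts G"
    and adj: "\<And>x y. x \<rightarrow>\<^bsub>G\<^esub> y \<Longrightarrow> f x = f y"
    and reach: "\<And>x y. x \<in> verts G \<Longrightarrow> y \<in> verts G \<Longrightarrow> f x = f y \<Longrightarrow> x \<rightarrow>\<^sup>* y"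
  shows "scc_of u = {v \<in> verts G. f v = f u}"
proof -
  have "f v = f u" if "u \<rightarrow>\<^sup>* v" for v
    using that by (induction rule: reachable_induct) (simp, metis adj)
  then show ?thesis
    using reach[OF assms(1)] reach[OF _ assms(1)] unfolding scc_of_def
    by (auto dest: reachable_in_verts)
qed

lemma sccs_eq_fibres:
  assumes "\<And>x y. x \<rightarrow>\<^bsub>G\<^esub> y \<Longrightarrow> f x = f y"
    and "\<And>x y. x \<in> verts G \<Longrightarrow> y \<in> verts G \<Longrightarrow> f x = f y \<Longrightarrow> x \<rightarrow>\<^sup>* y"
  shows "sccs = (\<lambda>u. G \<restriction> {v \<in> verts G. f v = f u}) ` verts G"
proof -
  have "scc_of u = {v \<in> verts G. f v = f u}" if "u \<in> verts G" for u
    using that assms by (rule scc_of_eq_fibre)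
  then show ?thesis
    by (simp add: sccs_conv_scc_of)
qed

end

section \<open>Perfect distance-dominating sets\<close>

context wf_digraph
begin

lemma graph_dist_set_scc_le_iff:
  assumes scc: "C \<in> pre_digraph.sccs (G \<restriction> S)" and near: "p \<in> S" "graph_dist G v p \<le> ereal (real t)"
    and ball: "{w \<in> S. graph_dist G v w \<le> ereal (real t)} \<subseteq> pre_digraph.scc_of (G \<restriction> S) p"
  shows "graph_dist_set G v (verts C) \<le> ereal (real t) \<longleftrightarrow> p \<in> verts C"
proof
  interpret GS: wf_digraph "G \<restriction> S"
    by (rule wellformed_induce_subgraph)
  assume "graph_dist_set G v (verts C) \<le> ereal (real t)"
  then obtain w where "w \<in> verts C" "graph_dist G v w \<le> ereal (real t)"
    by (auto simp: graph_dist_set_le_iff)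
  then have "C = (G \<restriction> S) \<restriction> GS.scc_of w" "w \<in> GS.scc_of p"
    using GS.scc_eq_induce_scc_of[OF scc] GS.verts_scc_subset[OF scc] ball by auto
  then show "p \<in> verts C"
    using near(1) GS.in_scc_of_self GS.scc_of_eq[of w p] by simp
qed (use near(2) in \<open>auto simp: graph_dist_set_le_iff\<close>)

text \<open>A ball around \<open>v\<close> that meets \<open>S\<close> only in \<open>p\<close> makes \<open>p\<close> the unique nearest vertex of \<open>S\<close>.\<close>

lemma PDDS_ballI:
  assumes "1 \<le> t" "S \<subseteq> verts G"
    and ball: "\<And>v. v \<in> verts G \<Longrightarrow> \<exists>n\<le>t. \<exists>p. {w \<in> S. graph_dist G v w \<le> ereal (real n)} = {p} \<and>
      {w \<in> S. graph_dist G v w \<le> ereal (real t)} \<subseteq> pre_digraph.scc_of (G \<restriction> S) p"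
  shows "PDDS G t S"
proof -
  interpret GS: wf_digraph "G \<restriction> S"
    by (rule wellformed_induce_subgraph)
  have "(\<exists>!C. C \<in> GS.sccs \<and> graph_dist_set G v (verts C) \<le> ereal (real t)) \<and>
      (\<forall>C\<in>GS.sccs. graph_dist_set G v (verts C) \<le> ereal (real t) \<longrightarrow>
         (\<exists>!w. w \<in> verts C \<and> graph_dist G v w = graph_dist_set G v (verts C)))"
    if "v \<in> verts G" for v
  proof -
    obtain n p where "n \<le> t" and ball_n: "{w \<in> S. graph_dist G v w \<le> ereal (real n)} = {p}"
      and ball_t: "{w \<in> S. graph_dist G v w \<le> ereal (real t)} \<subseteq> GS.scc_of p"
      using ball[OF \<open>v \<in> verts G\<close>] by blast
    then have near: "p \<in> S" "graph_dist G v p \<le> ereal (real t)"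
      by (auto intro: order_trans[of _ "ereal (real n)"])
    have near_iff: "graph_dist_set G v (verts C) \<le> ereal (real t) \<longleftrightarrow> p \<in> verts C"
      if "C \<in> GS.sccs" for C
      using that near ball_t by (rule graph_dist_set_scc_le_iff)
    have "\<exists>!C. C \<in> GS.sccs \<and> p \<in> verts C"
      using near(1) by (intro GS.ex1_scc_containing) simp
    moreover have "\<exists>!w. w \<in> verts C \<and> graph_dist G v w = graph_dist_set G v (verts C)"
      if "C \<in> GS.sccs" "p \<in> verts C" for C
      using ball_n that(2) GS.verts_scc_subset[OF that(1)]
      by (intro ex1_nearest_in_subset[of S v n p]) simp_all
    ultimately show ?thesis
      by (simp add: near_iff cong: conj_cong)
  qed
  then show ?thesis
    using assms(1,2) by (simp add: PDDS_def)
qed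

end

lemma (in sym_digraph) PDDS_1I:
  assumes "S \<subseteq> verts G"
    and dom: "\<And>v. v \<in> verts G - S \<Longrightarrow> \<exists>!w. w \<in> S \<and> v \<rightarrow>\<^bsub>G\<^esub> w"
  shows "PDDS G 1 S"
proof (rule PDDS_ballI)
  interpret GS: sym_digraph "G \<restriction> S"
    using assms(1) by (intro induced_graph_imp_graph induced_induce)
  fix v assume "v \<in> verts G"
  show "\<exists>n\<le>1. \<exists>p. {w \<in> S. graph_dist G v w \<le> ereal (real n)} = {p} \<and>
      {w \<in> S. graph_dist G v w \<le> ereal (real 1)} \<subseteq> GS.scc_of p"
  proof (cases "v \<in> S")
    case True
    have "w \<in> GS.scc_of v" if "w \<in> S" "graph_dist G v w \<le> 1" for w
    proof -
      have "v \<rightarrow>\<^sup>*\<^bsub>G \<restriction> S\<^esub> w"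
        using that True by (auto simp: graph_dist_le_1_iff arcs_ends_conv)
      then show ?thesis
        by (intro GS.scc_ofI_reachable')
    qed
    moreover have "{w \<in> S. graph_dist G v w \<le> 0} = {v}"
      using True \<open>v \<in> verts G\<close> by (auto simp: graph_dist_le_0_iff)
    ultimately show ?thesis
      by (intro exI[of _ 0] exI[of _ v]) (auto simp: zero_ereal_def one_ereal_def)
  next
    case False
    then obtain p where "p \<in> S" "{w \<in> S. v \<rightarrow>\<^bsub>G\<^esub> w} = {p}"
      using dom \<open>v \<in> verts G\<close> by blast
    moreover have "{w \<in> S. graph_dist G v w \<le> 1} = {w \<in> S. v \<rightarrow>\<^bsub>G\<^esub> w}"
      using False by (auto simp: graph_dist_le_1_iff)
    ultimately show ?thesis
      using GS.in_scc_of_self by (intro exI[of _ 1] exI[of _ p]) (simp add: one_ereal_def)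
  qed
qed (use assms(1) in auto)

lemma PDDS_of_digraph_iso:
  assumes "PDDS_of G t H S" "digraph_iso H H'"
  shows "PDDS_of G t H' S"
  using assms unfolding PDDS_of_def by (blast intro: digraph_iso_trans)

section \<open>Isomorphisms of digraphs without multiple arcs\<close>

lemma (in nomulti_digraph) nomulti_digraph_induce: "nomulti_digraph (G \<restriction> S)"
  using wellformed_induce_subgraph no_multi_arcs
  by (auto simp: nomulti_digraph_def nomulti_digraph_axioms_def arc_to_ends_def)

lemma nomulti_digraph_with_proj:
  assumes "wf_digraph (with_proj G)"
  shows "nomulti_digraph (with_proj G)"
  using assms
  by (auto simp: nomulti_digraph_def nomulti_digraph_axioms_def arc_to_ends_def prod_eq_iff)

lemma bij_betw_arcs_ends:
  assumes "wf_digraph G" "wf_digraph H"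
    and bij: "bij_betw f (verts G) (verts H)"
    and adj: "\<And>u v. u \<in> verts G \<Longrightarrow> v \<in> verts G \<Longrightarrow> u \<rightarrow>\<^bsub>G\<^esub> v \<longleftrightarrow> f u \<rightarrow>\<^bsub>H\<^esub> f v"
  shows "bij_betw (map_prod f f) (arcs_ends G) (arcs_ends H)"
proof (rule bij_betw_subset[OF bij_betw_map_prod[OF bij bij]])
  interpret G: wf_digraph G by fact
  interpret H: wf_digraph H by fact
  show "arcs_ends G \<subseteq> verts G \<times> verts G"
    by (auto dest: G.adj_in_verts)
  show "map_prod f f ` arcs_ends G = arcs_ends H"
  proof
    show "arcs_ends H \<subseteq> map_prod f f ` arcs_ends G"
    proof
      fix e assume "e \<in> arcs_ends H"
      then obtain u v where "u \<in> verts G" "v \<in> verts G" "e = (f u, f v)"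
        using bij_betw_imp_surj_on[OF bij] by (metis H.adj_in_verts imageE prod.exhaust)
      with \<open>e \<in> arcs_ends H\<close> adj show "e \<in> map_prod f f ` arcs_ends G"
        by (auto intro!: image_eqI[of _ _ "(u, v)"])
    qed
  qed (clarsimp, use adj G.adj_in_verts in blast)
qed

lemma digraph_isoI:
  assumes "nomulti_digraph G" "nomulti_digraph H"
    and bij: "bij_betw f (verts G) (verts H)"
    and adj: "\<And>u v. u \<in> verts G \<Longrightarrow> v \<in> verts G \<Longrightarrow> u \<rightarrow>\<^bsub>G\<^esub> v \<longleftrightarrow> f u \<rightarrow>\<^bsub>H\<^esub> f v"
  shows "digraph_iso G H"
proof -
  interpret G: nomulti_digraph G by fact
  interpret H: nomulti_digraph H by fact
  have bij_ends: "bij_betw (map_prod f f) (arcs_ends G) (arcs_ends H)"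
    using G.wf_digraph H.wf_digraph bij adj by (rule bij_betw_arcs_ends)
  have bij_arcs: "bij_betw (arc_to_ends K) (arcs K) (arcs_ends K)" if "nomulti_digraph K" for K
    using nomulti_digraph.inj_on_arc_to_ends[OF that] by (simp add: bij_betw_def arcs_ends_def)
  define g where "g = the_inv_into (arcs H) (arc_to_ends H) \<circ> map_prod f f \<circ> arc_to_ends G"
  have "bij_betw g (arcs G) (arcs H)"
    unfolding g_def using assms(1,2)
    by (intro bij_betw_trans[OF bij_arcs] bij_betw_trans[OF bij_ends] bij_betw_the_inv_into bij_arcs)
  moreover have "arc_to_ends H (g e) = map_prod f f (arc_to_ends G e)" if "e \<in> arcs G" for e
  proof -
    have "map_prod f f (arc_to_ends G e) \<in> arcs_ends H"
      using that bij_betwE[OF bij_ends] by (simp add: arcs_ends_def)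
    then show ?thesis
      using H.inj_on_arc_to_ends by (simp add: g_def f_the_inv_into_f arcs_ends_def)
  qed
  ultimately have "G.digraph_isomorphism
        \<lparr>iso_verts = f, iso_arcs = g, iso_head = head H, iso_tail = tail H\<rparr> \<and>
      H = app_iso \<lparr>iso_verts = f, iso_arcs = g, iso_head = head H, iso_tail = tail H\<rparr> G"
    using bij G.wf_digraph
    by (simp add: G.digraph_isomorphism_def app_iso_def bij_betw_def arc_to_ends_def)
  then show ?thesis
    unfolding digraph_iso_def by blast
qed

section \<open>Integer lattices and hypercubes\<close>

definition int_lattice :: "(int ^ 'n) pair_pre_digraph" where
  "int_lattice = \<lparr> pverts = UNIV,
     parcs = {(x, y). dist (\<chi> i. real_of_int (x $ i)) (\<chi> i. real_of_int (y $ i)) = 1} \<rparr>"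

definition hypercube :: "(bool ^ 'n) pair_pre_digraph" where
  "hypercube = \<lparr> pverts = UNIV, parcs = {(x, y). \<exists>!i. x $ i \<noteq> y $ i} \<rparr>"

lemma lattice3_eq_int_lattice: "lattice3 = int_lattice"
  by (simp add: lattice3_def int_lattice_def)

lemma pverts_int_lattice [simp]: "pverts int_lattice = UNIV"
  by (simp add: int_lattice_def)

lemma pverts_hypercube [simp]: "pverts hypercube = UNIV"
  by (simp add: hypercube_def)

lemma hypercube_arc_iff:
  "(x, y) \<in> parcs hypercube \<longleftrightarrow> (\<exists>i. x $ i \<noteq> y $ i \<and> (\<forall>j. j \<noteq> i \<longrightarrow> x $ j = y $ j))"
  unfolding hypercube_def by (simp, metis)

lemma int_lattice_arc_iff:
  "(x, y) \<in> parcs int_lattice \<longleftrightarrow> (\<exists>i. \<bar>x $ i - y $ i\<bar> = 1 \<and> (\<forall>j. j \<noteq> i \<longrightarrow> x $ j = y $ j))"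
proof -
  have "dist (\<chi> i. real_of_int (x $ i)) (\<chi> i. real_of_int (y $ i))
      = sqrt (real (\<Sum>i\<in>UNIV. (nat \<bar>x $ i - y $ i\<bar>)\<^sup>2))"
    by (simp add: dist_vec_def L2_set_def dist_real_def)
  then have "(x, y) \<in> parcs int_lattice \<longleftrightarrow> (\<Sum>i\<in>UNIV. (nat \<bar>x $ i - y $ i\<bar>)\<^sup>2) = 1"
    by (simp add: int_lattice_def del: of_nat_sum)
  also have "\<dots> \<longleftrightarrow> (\<exists>i. \<bar>x $ i - y $ i\<bar> = 1 \<and> (\<forall>j. j \<noteq> i \<longrightarrow> x $ j = y $ j))"
    by (subst sum_eq_1_iff) (auto simp: nat_eq_iff)
  finally show ?thesis .
qed

lemma sym_digraph_int_lattice: "sym_digraph (with_proj int_lattice)"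
  by unfold_locales (auto simp: symmetric_def int_lattice_def dist_commute intro: symI)

lemma wf_digraph_induce_int_lattice: "wf_digraph (with_proj int_lattice \<restriction> S)"
  by (intro wf_digraph.wellformed_induce_subgraph sym_digraph.axioms(1) sym_digraph_int_lattice)

lemma wf_digraph_hypercube: "wf_digraph (with_proj hypercube)"
  by (simp add: wf_digraph_def)

section \<open>Blocks of side two\<close>

definition block :: "int ^ 'n \<Rightarrow> int ^ 'n" where
  "block x = (\<chi> i. x $ i div 2)"

definition parity :: "int ^ 'n \<Rightarrow> bool ^ 'n" where
  "parity x = (\<chi> i. odd (x $ i))"

lemma block_nth [simp]: "block x $ i = x $ i div 2"
  by (simp add: block_def)

lemma parity_nth [simp]: "parity x $ i = odd (x $ i)"
  by (simp add: parity_def)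

lemma block_eq_iff: "block x = block y \<longleftrightarrow> (\<forall>i. x $ i div 2 = y $ i div 2)"
  by (simp add: vec_eq_iff)

lemma int_lattice_arc_in_block_iff:
  assumes "block x = block y"
  shows "(x, y) \<in> parcs int_lattice \<longleftrightarrow> (parity x, parity y) \<in> parcs hypercube"
proof -
  have same_pair: "x $ i div 2 = y $ i div 2" for i
    using assms by (simp add: block_eq_iff)
  have "\<bar>x $ i - y $ i\<bar> = 1 \<longleftrightarrow> odd (x $ i) \<noteq> odd (y $ i)" for i
    using same_pair[of i] by presburger
  moreover have "x $ i = y $ i \<longleftrightarrow> odd (x $ i) = odd (y $ i)" for i
    using same_pair[of i] by presburger
  ultimately show ?thesis
    by (simp add: int_lattice_arc_iff hypercube_arc_iff)
qed

lemma bij_betw_parity_block: "bij_betw parity {x. block x = b} UNIV"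
proof (rule bij_betw_byWitness[where f' = "\<lambda>p. \<chi> i. 2 * b $ i + of_bool (p $ i)"])
  show "\<forall>x\<in>{x. block x = b}. (\<chi> i. 2 * b $ i + of_bool (parity x $ i)) = x"
  proof
    fix x assume "x \<in> {x. block x = b}"
    then have "b = block x"
      by simp
    then show "(\<chi> i. 2 * b $ i + of_bool (parity x $ i)) = x"
      by (simp add: vec_eq_iff flip: mod_2_eq_odd)
  qed
qed (auto simp: vec_eq_iff)

lemma int_lattice_arc_cases:
  assumes "(x, y) \<in> parcs int_lattice"
  shows "block x = block y \<or> (parity (block x), parity (block y)) \<in> parcs hypercube"
proof -
  obtain i where unit_step: "\<bar>x $ i - y $ i\<bar> = 1" and "\<And>j. j \<noteq> i \<Longrightarrow> x $ j = y $ j"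
    using assms unfolding int_lattice_arc_iff by blast
  moreover have "x $ i div 2 = y $ i div 2 \<or> odd (x $ i div 2) \<noteq> odd (y $ i div 2)"
    using unit_step by presburger
  ultimately show ?thesis
    unfolding block_eq_iff hypercube_arc_iff by (metis block_nth parity_nth)
qed

lemma ex1_int_neighbour_in_other_pair:
  fixes k :: int
  shows "\<exists>!l. \<bar>k - l\<bar> = 1 \<and> odd (l div 2) \<noteq> odd (k div 2)"
proof -
  have "\<bar>k - l\<bar> = 1 \<and> odd (l div 2) \<noteq> odd (k div 2) \<longleftrightarrow> l = (if even k then k - 1 else k + 1)"
    for l
    by presburger
  then show ?thesis
    by simp
qed

lemma ex1_neighbour_parity_block:
  assumes "(parity (block x), p) \<in> parcs hypercube"
  shows "\<exists>!y. (x, y) \<in> parcs int_lattice \<and> parity (block y) = p"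
proof -
  obtain i where at_i: "p $ i \<noteq> odd (x $ i div 2)"
    and off_i: "\<And>j. j \<noteq> i \<Longrightarrow> p $ j = odd (x $ j div 2)"
    using assms unfolding hypercube_arc_iff by (metis block_nth parity_nth)
  obtain l where l_step: "\<bar>x $ i - l\<bar> = 1" "odd (l div 2) \<noteq> odd (x $ i div 2)"
    and l_unique: "\<And>k. \<bar>x $ i - k\<bar> = 1 \<Longrightarrow> odd (k div 2) \<noteq> odd (x $ i div 2) \<Longrightarrow> k = l"
    using ex1_int_neighbour_in_other_pair[of "x $ i"] by blast
  show ?thesis
  proof (rule ex1I[of _ "\<chi> j. if j = i then l else x $ j"])
    show "(x, \<chi> j. if j = i then l else x $ j) \<in> parcs int_lattice \<and>
        parity (block (\<chi> j. if j = i then l else x $ j)) = p"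
      using l_step at_i off_i by (auto simp: int_lattice_arc_iff vec_eq_iff)
    fix y assume y: "(x, y) \<in> parcs int_lattice \<and> parity (block y) = p"
    then obtain j where "\<bar>x $ j - y $ j\<bar> = 1" and off_j: "\<And>k. k \<noteq> j \<Longrightarrow> x $ k = y $ k"
      unfolding int_lattice_arc_iff by blast
    moreover have "odd (y $ i div 2) \<noteq> odd (x $ i div 2)"
      using y at_i by auto
    ultimately have "j = i" "y $ i = l"
      using l_unique by metis+
    with off_j show "y = (\<chi> j. if j = i then l else x $ j)"
      by (simp add: vec_eq_iff)
  qed
qed

lemma reachable_in_block:
  assumes "{z. block z = block x} \<subseteq> S" "block y = block x"
  shows "x \<rightarrow>\<^sup>*\<^bsub>with_proj int_lattice \<restriction> S\<^esub> y"
proof -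
  interpret GS: wf_digraph "with_proj int_lattice \<restriction> S"
    by (rule wf_digraph_induce_int_lattice)
  show ?thesis
    using assms
  proof (induction x rule: measure_induct_rule[where f = "\<lambda>x. card {i. x $ i \<noteq> y $ i}"])
    case (less x)
    show ?case
    proof (cases "x = y")
      case True
      then show ?thesis
        using less.prems(1) by (auto intro: GS.reachable_refl)
    next
      case False
      then obtain i where differ: "x $ i \<noteq> y $ i"
        by (auto simp: vec_eq_iff)
      define z where "z = (\<chi> j. if j = i then y $ i else x $ j)"
      have same_pair: "x $ i div 2 = y $ i div 2"
        using less.prems(2) by (simp add: block_eq_iff)
      then have block_z: "block z = block x"
        by (simp add: z_def block_eq_iff)
      have "\<bar>x $ i - y $ i\<bar> = 1"
        using differ same_pair by presburger
      then have "(x, z) \<in> parcs int_lattice"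
        unfolding int_lattice_arc_iff by (intro exI[of _ i]) (simp add: z_def)
      then have "x \<rightarrow>\<^bsub>with_proj int_lattice \<restriction> S\<^esub> z"
        using less.prems(1) block_z by (auto simp: arcs_ends_conv)
      moreover have "z \<rightarrow>\<^sup>*\<^bsub>with_proj int_lattice \<restriction> S\<^esub> y"
      proof (rule less.IH)
        show "card {j. z $ j \<noteq> y $ j} < card {j. x $ j \<noteq> y $ j}"
          using differ by (intro psubset_card_mono) (auto simp: z_def)
      qed (use less.prems block_z in simp_all)
      ultimately show ?thesis
        by (rule GS.adj_reachable_trans)
    qed
  qed
qed

section \<open>Cube packings from perfect codes\<close>

definition perfect_code :: "('a, 'b) pre_digraph \<Rightarrow> 'a set \<Rightarrow> bool" where
  "perfect_code G C \<longleftrightarrow> C \<subseteq> verts G \<and> (\<forall>v\<in>verts G. \<exists>!c. c \<in> C \<and> (v = c \<or> v \<rightarrow>\<^bsub>G\<^esub> c))"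

definition cube_packing :: "(bool ^ 'n) set \<Rightarrow> (int ^ 'n) set" where
  "cube_packing C = {x. parity (block x) \<in> C}"

lemma cube_packing_adj_same_block:
  assumes "perfect_code (with_proj hypercube) C"
    and "x \<in> cube_packing C" "y \<in> cube_packing C" "(x, y) \<in> parcs int_lattice"
  shows "block x = block y"
proof (rule ccontr)
  assume "block x \<noteq> block y"
  then have "(parity (block x), parity (block y)) \<in> parcs hypercube"
    using int_lattice_arc_cases[OF assms(4)] by simp
  then have "parity (block y) = parity (block x)"
    using assms(1-3) by (auto simp: perfect_code_def cube_packing_def)
  with \<open>(parity (block x), parity (block y)) \<in> parcs hypercube\<close> show False
    by (simp add: hypercube_arc_iff)
qed

lemma cube_packing_ex1_neighbour:
  assumes "perfect_code (with_proj hypercube) C" "x \<notin> cube_packing C"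
  shows "\<exists>!y. y \<in> cube_packing C \<and> (x, y) \<in> parcs int_lattice"
proof -
  have "parity (block x) \<notin> C"
    using assms(2) by (simp add: cube_packing_def)
  then obtain c where "c \<in> C" "(parity (block x), c) \<in> parcs hypercube"
    and c_unique: "\<And>c'. c' \<in> C \<Longrightarrow> (parity (block x), c') \<in> parcs hypercube \<Longrightarrow> c' = c"
    using assms(1) by (auto simp: perfect_code_def) metis
  have "y \<in> cube_packing C \<and> (x, y) \<in> parcs int_lattice \<longleftrightarrow>
      (x, y) \<in> parcs int_lattice \<and> parity (block y) = c" for y
    using int_lattice_arc_cases[of x y] \<open>c \<in> C\<close> \<open>parity (block x) \<notin> C\<close> c_unique
    by (auto simp: cube_packing_def)
  then show ?thesis
    using ex1_neighbour_parity_block[OF \<open>(parity (block x), c) \<in> parcs hypercube\<close>] by simp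
qed

lemma sccs_cube_packing:
  assumes "perfect_code (with_proj hypercube) C"
  shows "pre_digraph.sccs (with_proj int_lattice \<restriction> cube_packing C)
    = (\<lambda>x. with_proj int_lattice \<restriction> {y. block y = block x}) ` cube_packing C"
    (is "pre_digraph.sccs (?L \<restriction> ?S) = _")
proof -
  interpret GS: wf_digraph "?L \<restriction> ?S"
    by (rule wf_digraph_induce_int_lattice)
  have block_subset: "{y. block y = block x} \<subseteq> ?S" if "x \<in> ?S" for x
    using that by (auto simp: cube_packing_def)
  have "GS.sccs = (\<lambda>x. (?L \<restriction> ?S) \<restriction> {y \<in> verts (?L \<restriction> ?S). block y = block x}) ` verts (?L \<restriction> ?S)"
  proof (rule GS.sccs_eq_fibres)
    show "block x = block y" if "x \<rightarrow>\<^bsub>?L \<restriction> ?S\<^esub> y" for x y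
      using that cube_packing_adj_same_block[OF assms] by (auto simp: arcs_ends_conv)
    show "x \<rightarrow>\<^sup>*\<^bsub>?L \<restriction> ?S\<^esub> y" if "x \<in> verts (?L \<restriction> ?S)" "block x = block y" for x y
      using that by (intro reachable_in_block block_subset) simp_all
  qed
  moreover have "(?L \<restriction> ?S) \<restriction> {y \<in> ?S. block y = block x} = ?L \<restriction> {y. block y = block x}"
    if "x \<in> ?S" for x
    using block_subset[OF that] by (auto simp: induce_subgraph_def)
  ultimately show ?thesis
    by simp
qed

lemma digraph_iso_block_hypercube:
  fixes b :: "int ^ 'n"
  shows "digraph_iso (with_proj int_lattice \<restriction> {x. block x = b})
    (with_proj (hypercube :: (bool ^ 'n) pair_pre_digraph))"
    (is "digraph_iso ?B ?Q")
proof (rule digraph_isoI)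
  show "nomulti_digraph ?B"
    by (intro nomulti_digraph.nomulti_digraph_induce nomulti_digraph_with_proj
        sym_digraph.axioms(1) sym_digraph_int_lattice)
  show "nomulti_digraph ?Q"
    by (intro nomulti_digraph_with_proj wf_digraph_hypercube)
  show "bij_betw parity (verts ?B) (verts ?Q)"
    by (simp add: bij_betw_parity_block)
qed (auto simp: int_lattice_arc_in_block_iff arcs_ends_conv)

theorem PDDS_of_cube_packing:
  fixes C :: "(bool ^ 'n) set"
  assumes "perfect_code (with_proj hypercube) C"
  shows "PDDS_of (with_proj int_lattice) 1 (with_proj (hypercube :: (bool ^ 'n) pair_pre_digraph))
    (cube_packing C)"
proof -
  have "PDDS (with_proj int_lattice) 1 (cube_packing C)"
    using cube_packing_ex1_neighbour[OF assms]
    by (intro sym_digraph.PDDS_1I sym_digraph_int_lattice) auto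
  then show ?thesis
    by (auto simp: PDDS_of_def sccs_cube_packing[OF assms] digraph_iso_block_hypercube)
qed

section \<open>Dimension three\<close>

lemma exists_3: "(\<exists>i::3. P i) \<longleftrightarrow> P 1 \<or> P 2 \<or> P 3"
  using forall_3[of "\<lambda>i. \<not> P i"] by blast

lemma perfect_code_range_vec3:
  "perfect_code (with_proj (hypercube :: (bool ^ 3) pair_pre_digraph)) (range vec)"
  unfolding perfect_code_def
proof (intro conjI ballI)
  fix x :: "bool ^ 3"
  show "\<exists>!c. c \<in> range vec \<and> (x = c \<or> x \<rightarrow>\<^bsub>with_proj hypercube\<^esub> c)"
    by (cases "x $ 1"; cases "x $ 2"; cases "x $ 3")
      (auto simp: hypercube_arc_iff vec_eq_iff forall_3 exists_3)
qed simp

lemma pverts_hypercube3: "pverts hypercube3 = {..<2} \<times> {..<2} \<times> {..<2}"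
  by (simp add: hypercube3_def cartesian_product_def path_graph_def)

lemma digraph_iso_hypercube_hypercube3:
  "digraph_iso (with_proj (hypercube :: (bool ^ 3) pair_pre_digraph)) (with_proj hypercube3)"
  (is "digraph_iso ?Q _")
proof (rule digraph_isoI)
  let ?f = "\<lambda>x :: bool ^ 3. (of_bool (x $ 1), of_bool (x $ 2), of_bool (x $ 3)) :: nat \<times> nat \<times> nat"
  show "nomulti_digraph ?Q"
    by (intro nomulti_digraph_with_proj wf_digraph_hypercube)
  show "nomulti_digraph (with_proj hypercube3)"
    using hypercube3_pair_graph
    by (simp add: nomulti_digraph_with_proj wf_digraph_wp_iff pair_graph_def pair_digraph_def
        pair_fin_digraph_def)
  show "bij_betw ?f (verts ?Q) (verts (with_proj hypercube3))"
    by (rule bij_betw_byWitness[where f' = "\<lambda>(a, b, c).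
        \<chi> i. if i = 1 then a = 1 else if i = 2 then b = 1 else c = 1"])
      (auto simp: pverts_hypercube3 vec_eq_iff forall_3 less_2_cases_iff)
  show "x \<rightarrow>\<^bsub>?Q\<^esub> y \<longleftrightarrow> ?f x \<rightarrow>\<^bsub>with_proj hypercube3\<^esub> ?f y" for x y
    by (cases "x $ 1"; cases "x $ 2"; cases "x $ 3"; cases "y $ 1"; cases "y $ 2"; cases "y $ 3")
      (simp_all add: hypercube_arc_iff forall_3 exists_3 hypercube3_def cartesian_product_def
        path_graph_def)
qed

theorem theorem4:
  shows "\<exists>S. PDDS_of (with_proj lattice3) 1 (with_proj hypercube3) S"
proof
  show "PDDS_of (with_proj lattice3) 1 (with_proj hypercube3) (cube_packing (range vec))"
    unfolding lattice3_eq_int_lattice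
    using PDDS_of_cube_packing[OF perfect_code_range_vec3] digraph_iso_hypercube_hypercube3
    by (rule PDDS_of_digraph_iso)
qed

end
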